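(* Let $K$ be a first-countable compact Hausdorff space. Suppose that every interval $[f,g]$ in canonical representation in $C(K)$ satisfying $-g\le f\le 0<g$ (pointwise on $K$) has a square root which is an interval. Then $K$ is finite.
   Context: $C(K)$ is the Banach algebra of continuous real functions on $K$ with the supremum norm. For $A,B\subset C(K)$, $A\cdot B=\{ab: a\in A,\ b\in B\}$ with pointwise products. An interval in $C(K)$ is a set of the form $[f,g]=\{h\in C(K): f\le h\le g\}$, where $f,g:K\to\mathbb{R}$ are bounded functions (not necessarily continuous) and inequalities between functions are pointwise. The interval $[f,g]$ is in canonical representation if $f$ is upper semicontinuous, $g$ is lower semicontinuous and $f\le g$. A convex body in $C(K)$ is a nonempty bounded closed convex subset of $C(K)$. A convex body $C$ is a square root of the interval $[f,g]$ if $C\cdot C=[f,g]$. *)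

theory Defs
  imports "HOL-Analysis.Analysis" "HOL-Library.Set_Algebras"
begin

text \<open>
  A compact Hausdorff space \<open>K\<close> is modelled as a \<^class>\<open>t2_space\<close> type whose universe is compact.
  Then \<open>C(K)\<close>, with the supremum norm, is the library type \<open>K \<Rightarrow>\<^sub>C real\<close> of bounded
  continuous functions, since boundedness is automatic on a compact space.
  The library provides its normed space structure, but not the pointwise product; the product
  \<open>A * B\<close> of sets is then the one of \<^theory>\<open>HOL-Library.Set_Algebras\<close>.
\<close>

instantiation bcontfun :: (topological_space, real_normed_algebra) times
begin

definition times_bcontfun :: "('a \<Rightarrow>\<^sub>C 'b) \<Rightarrow> ('a \<Rightarrow>\<^sub>C 'b) \<Rightarrow> ('a \<Rightarrow>\<^sub>C 'b)"
  where "times_bcontfun a b = Bcontfun (\<lambda>x. apply_bcontfun a x * apply_bcontfun b x)"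

instance ..

end

lemma apply_bcontfun_times [simp]:
  fixes a b :: "'a::topological_space \<Rightarrow>\<^sub>C 'b::real_normed_algebra"
  shows "apply_bcontfun (a * b) x = apply_bcontfun a x * apply_bcontfun b x"
proof -
  have "norm (apply_bcontfun a y * apply_bcontfun b y) \<le> norm a * norm b" for y
    by (rule order_trans[OF norm_mult_ineq]) (intro mult_mono norm_bounded norm_ge_zero)
  then have "(\<lambda>y. apply_bcontfun a y * apply_bcontfun b y) \<in> bcontfun"
    by (intro bcontfun_normI[where b = "norm a * norm b"] continuous_on_mult
        continuous_on_apply_bcontfun)
  then show ?thesis
    by (simp add: times_bcontfun_def Bcontfun_inverse)
qed

definition upper_semicontinuous :: "('a::topological_space \<Rightarrow> real) \<Rightarrow> bool"
  where "upper_semicontinuous f \<longleftrightarrow> (\<forall>c. open {x. f x < c})"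

definition lower_semicontinuous :: "('a::topological_space \<Rightarrow> real) \<Rightarrow> bool"
  where "lower_semicontinuous f \<longleftrightarrow> (\<forall>c. open {x. c < f x})"

text \<open>The end points \<open>f\<close>, \<open>g\<close> of an interval are arbitrary, not necessarily continuous, functions;
  their boundedness is required where intervals are quantified over.\<close>

definition C_interval :: "('a::topological_space \<Rightarrow> real) \<Rightarrow> ('a \<Rightarrow> real) \<Rightarrow> ('a \<Rightarrow>\<^sub>C real) set"
  where "C_interval f g = {h. \<forall>x. f x \<le> apply_bcontfun h x \<and> apply_bcontfun h x \<le> g x}"

definition is_interval_C :: "('a::topological_space \<Rightarrow>\<^sub>C real) set \<Rightarrow> bool"
  where "is_interval_C S \<longleftrightarrow>
    (\<exists>f g. bounded (range f) \<and> bounded (range g) \<and> S = C_interval f g)"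

definition canonical_representation :: "('a::topological_space \<Rightarrow> real) \<Rightarrow> ('a \<Rightarrow> real) \<Rightarrow> bool"
  where "canonical_representation f g \<longleftrightarrow>
    bounded (range f) \<and> bounded (range g) \<and>
    upper_semicontinuous f \<and> lower_semicontinuous g \<and> (\<forall>x. f x \<le> g x)"

definition convex_body :: "'v::real_normed_vector set \<Rightarrow> bool"
  where "convex_body S \<longleftrightarrow> S \<noteq> {} \<and> bounded S \<and> closed S \<and> convex S"

definition is_square_root_of ::
    "('a::topological_space \<Rightarrow>\<^sub>C real) set \<Rightarrow> ('a \<Rightarrow>\<^sub>C real) set \<Rightarrow> bool"
  where "is_square_root_of S I \<longleftrightarrow> convex_body S \<and> S * S = I"

end

theory Submission
  imports Defs
begin

text \<open>
  If \<open>K\<close> is infinite, it has a non-isolated point \<open>p\<close>. Let \<open>f = -1\<close>, let \<open>g(p) = 1\<close> and \<open>g = 4\<close>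
  elsewhere, and suppose \<open>S * S = [f, g]\<close>. The factors of the constant \<open>-1\<close> take the values
  \<open>1\<close> and \<open>-1\<close> at \<open>p\<close>, because squares of elements of \<open>S\<close> are at most \<open>g\<close>; by continuity
  they lie above \<open>1/2\<close> and below \<open>-1/2\<close> at some \<open>x \<noteq> p\<close>. By Urysohn's lemma \<open>[f, g]\<close> has an
  element with value \<open>4\<close> at \<open>x\<close>, whose factors take the value \<open>2\<close> or \<open>-2\<close> there. Multiplying
  such a factor by one of the first two gives an element of \<open>S * S\<close> that is below \<open>-1\<close> at \<open>x\<close>.
\<close>

text \<open>A compact Hausdorff space is normal and its points are closed, so Urysohn's lemma
  applies to two points.\<close>

lemma compact_Urysohn_bcontfun:
  fixes p x :: "'k::t2_space" and a b :: real
  assumes "compact (UNIV :: 'k set)" and "x \<noteq> p" and "a \<le> b"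
  obtains c :: "'k \<Rightarrow>\<^sub>C real"
  where "apply_bcontfun c p = a" "apply_bcontfun c x = b"
    "\<And>y. a \<le> apply_bcontfun c y \<and> apply_bcontfun c y \<le> b"
proof -
  have "Hausdorff_space (euclidean :: 'k topology)"
    using hausdorff by (auto simp: Hausdorff_space_def disjnt_def)
  then have "normal_space (euclidean :: 'k topology)"
    using assms(1)
    by (intro compact_Hausdorff_or_regular_imp_normal_space) (auto simp: compact_space_def)
  then obtain h where h: "continuous_map euclidean (top_of_set {a..b}) h"
    "h ` {p} \<subseteq> {a}" "h ` {x} \<subseteq> {b}"
    using Urysohn_lemma[of "euclidean :: 'k topology" "{p}" "{x}" a b] assms
    by (auto simp: closed_closedin[symmetric])
  have cont: "continuous_on UNIV h" and range: "\<And>y. h y \<in> {a..b}"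
    using h(1) by (auto simp: continuous_map_in_subtopology)
  have "bounded (range h)"
    by (rule bounded_subset[OF bounded_closed_interval[of a b]]) (use range in auto)
  with cont have "h \<in> bcontfun"
    by (simp add: bcontfun_def)
  then show ?thesis
    using that[of "Bcontfun h"] h range by (auto simp: Bcontfun_inverse)
qed

text \<open>Used to turn a known product and an upper bound on one factor into a lower bound on the
  other.\<close>

lemma abs_factor_ge:
  fixes x y r :: real
  assumes "\<bar>y\<bar> \<le> r"
  shows "\<bar>x * y\<bar> \<le> r * \<bar>x\<bar>"
  using mult_right_mono[OF assms abs_ge_zero[of x]] by (simp add: abs_mult mult.commute)

lemma no_square_root_at_nonisolated_point:
  fixes p :: "'k::t2_space" and S :: "('k \<Rightarrow>\<^sub>C real) set"
  assumes compact: "compact (UNIV :: 'k set)" and p: "p islimpt UNIV"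
  shows "S * S \<noteq> C_interval (\<lambda>_. - 1) (\<lambda>x. if x = p then 1 else 4)"
proof
  define g :: "'k \<Rightarrow> real" where "g = (\<lambda>x. if x = p then 1 else 4)"
  assume "S * S = C_interval (\<lambda>_. - 1) (\<lambda>x. if x = p then 1 else 4)"
  then have S: "S * S = C_interval (\<lambda>_. - 1) g"
    by (simp add: g_def)
  \<comment> \<open>With \<open>s = t\<close> this bounds the absolute value of \<open>s\<close> by
    1 at \<open>p\<close> and by 2 elsewhere.\<close>
  have prod: "- 1 \<le> apply_bcontfun s y * apply_bcontfun t y
      \<and> apply_bcontfun s y * apply_bcontfun t y \<le> g y"
    if "s \<in> S" "t \<in> S" for s t y
  proof -
    have "s * t \<in> C_interval (\<lambda>_. - 1) g"
      using set_times_intro[OF that] S by simp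
    then show ?thesis
      by (auto simp: C_interval_def dest: spec[where x = y])
  qed
  have "const_bcontfun (- 1) \<in> S * S"
    by (simp add: S C_interval_def g_def)
  then obtain a0 b0 where ab0: "a0 \<in> S" "b0 \<in> S" "const_bcontfun (- 1) = a0 * b0"
    by (rule set_times_elim)
  have neg: "apply_bcontfun a0 p * apply_bcontfun b0 p = - 1"
    by (metis ab0(3) apply_bcontfun_times const_bcontfun.rep_eq)
  have "\<bar>apply_bcontfun a0 p\<bar> \<le> 1" "\<bar>apply_bcontfun b0 p\<bar> \<le> 1"
    using prod[OF ab0(1) ab0(1), of p] prod[OF ab0(2) ab0(2), of p]
    by (auto simp: g_def power2_eq_square simp flip: abs_square_le_1)
  then have "1 \<le> \<bar>apply_bcontfun a0 p\<bar>" "1 \<le> \<bar>apply_bcontfun b0 p\<bar>"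
    using abs_factor_ge[of "apply_bcontfun b0 p" 1 "apply_bcontfun a0 p"]
      abs_factor_ge[of "apply_bcontfun a0 p" 1 "apply_bcontfun b0 p"] neg
    by (auto simp: mult.commute)
  moreover have "apply_bcontfun a0 p * apply_bcontfun b0 p < 0"
    using neg by simp
  \<comment> \<open>Why 1/2: a value of size at least 2 times one of size above 1/2 has size above
    1. The values at \<open>p\<close> are 1 and -1, so these strict bounds persist near
    \<open>p\<close>.\<close>
  ultimately have "apply_bcontfun a0 p > 1/2 \<and> apply_bcontfun b0 p < - 1/2 \<or>
      apply_bcontfun b0 p > 1/2 \<and> apply_bcontfun a0 p < - 1/2"
    by (auto simp: mult_less_0_iff)
  then obtain a b where ab: "a \<in> S" "b \<in> S"
    "apply_bcontfun a p > 1/2" "apply_bcontfun b p < - 1/2"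
    using ab0 by blast
  define U where "U = {y. apply_bcontfun a y > 1/2} \<inter> {y. apply_bcontfun b y < - 1/2}"
  have "open U"
    unfolding U_def by (intro open_Int open_Collect_less continuous_on_apply_bcontfun continuous_intros)
  moreover have "p \<in> U"
    using ab by (simp add: U_def)
  ultimately obtain x where x: "x \<in> U" "x \<noteq> p"
    using p by (meson islimptE UNIV_I)
  \<comment> \<open>The value 1 at \<open>p\<close> keeps \<open>c\<close> below \<open>g\<close>
    where \<open>g\<close> drops.\<close>
  obtain c :: "'k \<Rightarrow>\<^sub>C real" where c: "apply_bcontfun c p = 1" "apply_bcontfun c x = 4"
    "\<And>y. 1 \<le> apply_bcontfun c y \<and> apply_bcontfun c y \<le> 4"
    using compact_Urysohn_bcontfun[OF compact x(2), of 1 4] by auto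
  have "- 1 \<le> apply_bcontfun c y \<and> apply_bcontfun c y \<le> g y" for y
    using c(1) c(3)[of y] by (auto simp: g_def)
  then have "c \<in> S * S"
    by (simp add: S C_interval_def)
  then obtain d e where de: "d \<in> S" "e \<in> S" "c = d * e"
    by (rule set_times_elim)
  have "apply_bcontfun d x * apply_bcontfun e x = 4"
    using c(2) de(3) by simp
  moreover have "\<bar>apply_bcontfun e x\<bar> \<le> 2"
    using prod[OF de(2) de(2), of x] x(2) abs_le_square_iff[of "apply_bcontfun e x" 2]
    by (simp add: g_def power2_eq_square)
  ultimately have "2 \<le> \<bar>apply_bcontfun d x\<bar>"
    using abs_factor_ge[of "apply_bcontfun e x" 2 "apply_bcontfun d x"] by simp
  then consider "2 \<le> apply_bcontfun d x" | "apply_bcontfun d x \<le> - 2"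
    by linarith
  then show False
  \<comment> \<open>\<open>d\<close> is paired with whichever of \<open>a\<close>, \<open>b\<close>
    has the opposite sign at \<open>x\<close>.\<close>
  proof cases
    case 1
    then have "2 * (1/2) < apply_bcontfun d x * - apply_bcontfun b x"
      using x(1) by (intro mult_le_less_imp_less) (auto simp: U_def)
    then show False
      using prod[OF de(1) ab(2), of x] by simp
  next
    case 2
    then have "2 * (1/2) < - apply_bcontfun d x * apply_bcontfun a x"
      using x(1) by (intro mult_le_less_imp_less) (auto simp: U_def)
    then show False
      using prod[OF de(1) ab(1), of x] by simp
  qed
qed

text \<open>Lowering a constant at one point keeps it lower semicontinuous, since the complement of
  a point is open.\<close>

lemma canonical_representation_punctured:
  fixes p :: "'k::t1_space"
  shows "canonical_representation (\<lambda>_. - 1) (\<lambda>x. if x = p then 1 else 4)"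
proof -
  have "{x. c < (if x = p then 1 else 4)} = (if c < 1 then UNIV else if c < 4 then - {p} else {})"
    for c :: real
    by auto
  then have "lower_semicontinuous (\<lambda>x. if x = p then 1 else 4)"
    by (auto simp: lower_semicontinuous_def open_Compl)
  moreover have "bounded (range (\<lambda>x. if x = p then 1 else 4 :: real))"
    by (rule bounded_subset[of "{1, 4}"]) auto
  ultimately show ?thesis
    by (auto simp: canonical_representation_def upper_semicontinuous_def)
qed

theorem theorem5p2:
  assumes "compact (UNIV :: 'k::{t2_space, first_countable_topology} set)"
    and "\<And>f g :: 'k \<Rightarrow> real.
      canonical_representation f g \<Longrightarrow> (\<forall>x. - g x \<le> f x \<and> f x \<le> 0 \<and> 0 < g x) \<Longrightarrow>
      \<exists>S. is_square_root_of S (C_interval f g) \<and> is_interval_C S"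
  shows "finite (UNIV :: 'k set)"
proof (rule ccontr)
  assume "infinite (UNIV :: 'k set)"
  then obtain p :: 'k where p: "p islimpt UNIV"
    using Heine_Borel_imp_Bolzano_Weierstrass[OF assms(1)] by blast
  \<comment> \<open>The condition \<open>-g \<le> f\<close> holds since \<open>g\<close> takes only
    the values 1 and 4.\<close>
  obtain S where "is_square_root_of S (C_interval (\<lambda>_. - 1) (\<lambda>x. if x = p then 1 else 4))"
    using assms(2)[OF canonical_representation_punctured, of p] by fastforce
  then show False
    using no_square_root_at_nonisolated_point[OF assms(1) p] by (auto simp: is_square_root_of_def)
qed

end
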